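(* Let $u_{x,y}$ be a generalized kernel, let $W_C(x)=\prod_{i=1}^{d}(x-r_i)^{m_i}$ be a monic polynomial with distinct roots $r_1,\dots,r_d\in\mathbb{C}$ and degree $N_C=\sum_{i=1}^d m_i\ge 1$, and let $\hat u_{x,y}=W_C(x)u_{x,y}$ be the Christoffel perturbation. Assume that both $u$ and $\hat u$ are quasi-definite. Then for every $n\ge 0$ the perturbed biorthogonal polynomials and norms are $$\hat P_{1,n}(x)=\frac{1}{W_C(x)}\,\Theta_*\begin{bmatrix}\mathcal J_r[P_{1,n}] & P_{1,n}(x)\\ \vdots&\vdots\\ \mathcal J_r[P_{1,n+N_C}] & P_{1,n+N_C}(x)\end{bmatrix},$$ $$\hat H_n=\Theta_*\begin{bmatrix}\mathcal J_r[P_{1,n}] & H_n\\ \mathcal J_r[P_{1,n+1}] & 0\\ \vdots&\vdots\\ \mathcal J_r[P_{1,n+N_C}] & 0\end{bmatrix},$$ $$\hat P_{2,n}(y)=-\Theta_*\begin{bmatrix}\mathcal J_r[P_{1,n}] & H_n\\ \mathcal J_r[P_{1,n+1}] & 0\\ \vdots&\vdots\\ \mathcal J_r[P_{1,n+N_C-1}] & 0\\ \mathcal J_r[K_n(\cdot,y)] & 0\end{bmatrix}.$$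
   Context: A generalized kernel $u_{x,y}$ is here a linear functional on $\mathbb{C}[x,y]$; it gives the bilinear form $\langle P(x),Q(y)\rangle_u=u(P(x)Q(y))$ on $\mathbb{C}[x]$, with semi-infinite Gram matrix $G=(G_{k,l})_{k,l\ge 0}$, $G_{k,l}=\langle x^k,y^l\rangle_u$. It is quasi-definite if all leading principal minors $\det (G_{i,j})_{i,j=0}^{k-1}$, $k\ge 1$, are nonzero. Then $G$ factors uniquely as $G=S_1^{-1}HS_2^{-\top}$ with $S_1,S_2$ lower unitriangular and $H=\operatorname{diag}(H_0,H_1,\dots)$. With $\chi(x)=(1,x,x^2,\dots)^\top$, the biorthogonal polynomials are the entries of $S_1\chi(x)=(P_{1,0}(x),P_{1,1}(x),\dots)^\top$ and $S_2\chi(x)=(P_{2,0}(x),P_{2,1}(x),\dots)^\top$; they are monic with $\deg P_{i,k}=k$. The Christoffel–Darboux kernel is $K_n(x,y)=\sum_{k=0}^n P_{2,k}(y)H_k^{-1}P_{1,k}(x)$. The perturbed kernel acts by $\langle P(x),Q(y)\rangle_{\hat u}=\langle W_C(x)P(x),Q(y)\rangle_u$. Hatted objects $\hat P_{1,n},\hat P_{2,n},\hat H_n$ are those associated with $\hat u$. The jet of a function $f$ is the row vector with $N_C$ entries $$\mathcal J_r[f]=\Big(\tfrac{f(r_1)}{0!},\tfrac{f'(r_1)}{1!},\dots,\tfrac{f^{(m_1-1)}(r_1)}{(m_1-1)!};\ \dots;\ \tfrac{f(r_d)}{0!},\dots,\tfrac{f^{(m_d-1)}(r_d)}{(m_d-1)!}\Big).$$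 $\mathcal J_r[K_n(\cdot,y)]$ is the jet with respect to the first variable of $K_n$. For a square matrix $M=\begin{pmatrix}A&b\\c&e\end{pmatrix}$ with $e$ the scalar in the last row and last column and $A$ nonsingular, $\Theta_*(M)=e-cA^{-1}b$ (the last quasi-determinant). *)

theory Defs
  imports
    "HOL-Analysis.Derivative"
    "HOL-Computational_Algebra.Polynomial"
    "Jordan_Normal_Form.Gauss_Jordan_Elimination"
    "Jordan_Normal_Form.Determinant"
begin

(* The ring C[x,y] is represented as (C[x])[y], i.e. "complex poly poly" with outer
   variable y and coefficients in C[x]. *)

definition in_x :: "complex poly \<Rightarrow> complex poly poly" where
  "in_x P = [:P:]"

definition in_y :: "complex poly \<Rightarrow> complex poly poly" where
  "in_y Q = map_poly (\<lambda>c. [:c:]) Q"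

definition generalized_kernel :: "(complex poly poly \<Rightarrow> complex) \<Rightarrow> bool" where
  "generalized_kernel u \<longleftrightarrow> Vector_Spaces.linear (\<lambda>c p. smult [:c:] p) (*) u"

definition kernel_form ::
  "(complex poly poly \<Rightarrow> complex) \<Rightarrow> complex poly \<Rightarrow> complex poly \<Rightarrow> complex" where
  "kernel_form u P Q = u (in_x P * in_y Q)"

definition perturbed_kernel ::
  "complex poly \<Rightarrow> (complex poly poly \<Rightarrow> complex) \<Rightarrow> complex poly poly \<Rightarrow> complex" where
  "perturbed_kernel W u = (\<lambda>p. u (in_x W * p))"

type_synonym semi_inf_mat = "nat \<Rightarrow> nat \<Rightarrow> complex"

definition gram :: "(complex poly poly \<Rightarrow> complex) \<Rightarrow> semi_inf_mat" where
  "gram u k l = kernel_form u (monom 1 k) (monom 1 l)"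

definition quasi_definite :: "(complex poly poly \<Rightarrow> complex) \<Rightarrow> bool" where
  "quasi_definite u \<longleftrightarrow>
     (\<forall>k\<ge>1. Determinant.det (Matrix.mat k k (\<lambda>(i, j). gram u i j)) \<noteq> 0)"

definition lower_unitriangular :: "semi_inf_mat \<Rightarrow> bool" where
  "lower_unitriangular S \<longleftrightarrow> (\<forall>i. S i i = 1) \<and> (\<forall>i j. i < j \<longrightarrow> S i j = 0)"

definition diag_si :: "(nat \<Rightarrow> complex) \<Rightarrow> semi_inf_mat" where
  "diag_si h = (\<lambda>i j. if i = j then h i else 0)"

definition transpose_si :: "semi_inf_mat \<Rightarrow> semi_inf_mat" where
  "transpose_si A = (\<lambda>i j. A j i)"

(* The matrix product L A, to be used only when L is lower triangular: then entry (i,k)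
   of L vanishes for k > i and the infinite sum over k reduces to k <= i. *)
definition lower_times :: "semi_inf_mat \<Rightarrow> semi_inf_mat \<Rightarrow> semi_inf_mat" where
  "lower_times L A = (\<lambda>i j. \<Sum>k\<le>i. L i k * A k j)"

definition lower_inverse :: "semi_inf_mat \<Rightarrow> semi_inf_mat" where
  "lower_inverse S = (THE T. lower_unitriangular T \<and>
     lower_times S T = diag_si (\<lambda>_. 1) \<and> lower_times T S = diag_si (\<lambda>_. 1))"

definition gauss_borel ::
  "semi_inf_mat \<Rightarrow> semi_inf_mat \<Rightarrow> (nat \<Rightarrow> complex) \<Rightarrow> semi_inf_mat \<Rightarrow> bool" where
  "gauss_borel G S1 H S2 \<longleftrightarrow>
     lower_unitriangular S1 \<and> lower_unitriangular S2 \<and>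
     G = lower_times (lower_inverse S1)
           (lower_times (diag_si H) (transpose_si (lower_inverse S2)))"

(* For quasi-definite u the triple is unique, so the description is proper. *)
definition factors ::
  "(complex poly poly \<Rightarrow> complex) \<Rightarrow> semi_inf_mat \<times> (nat \<Rightarrow> complex) \<times> semi_inf_mat" where
  "factors u = (THE (S1, H, S2). gauss_borel (gram u) S1 H S2)"

definition factor_S1 :: "(complex poly poly \<Rightarrow> complex) \<Rightarrow> semi_inf_mat" where
  "factor_S1 u = fst (factors u)"

definition factor_H :: "(complex poly poly \<Rightarrow> complex) \<Rightarrow> nat \<Rightarrow> complex" where
  "factor_H u = fst (snd (factors u))"

definition factor_S2 :: "(complex poly poly \<Rightarrow> complex) \<Rightarrow> semi_inf_mat" where
  "factor_S2 u = snd (snd (factors u))"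

(* Entry n of S chi(x) with chi(x) = (1, x, x^2, ...); S is lower triangular. *)
definition row_poly :: "semi_inf_mat \<Rightarrow> nat \<Rightarrow> complex poly" where
  "row_poly S n = (\<Sum>k\<le>n. monom (S n k) k)"

definition biorth1 :: "(complex poly poly \<Rightarrow> complex) \<Rightarrow> nat \<Rightarrow> complex poly" where
  "biorth1 u n = row_poly (factor_S1 u) n"

definition biorth2 :: "(complex poly poly \<Rightarrow> complex) \<Rightarrow> nat \<Rightarrow> complex poly" where
  "biorth2 u n = row_poly (factor_S2 u) n"

definition CD_kernel ::
  "(complex poly poly \<Rightarrow> complex) \<Rightarrow> nat \<Rightarrow> complex \<Rightarrow> complex \<Rightarrow> complex" where
  "CD_kernel u n x y =
     (\<Sum>k\<le>n. poly (biorth2 u k) y * inverse (factor_H u k) * poly (biorth1 u k) x)"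

definition jet ::
  "nat \<Rightarrow> (nat \<Rightarrow> complex) \<Rightarrow> (nat \<Rightarrow> nat) \<Rightarrow> (complex \<Rightarrow> complex) \<Rightarrow> complex list" where
  "jet d r m f =
     concat (map (\<lambda>i. map (\<lambda>j. (deriv ^^ j) f (r i) / fact j) [0..<m i]) [1..<d + 1])"

(* The last quasi-determinant e - c A^(-1) b of the block matrix (A, b; c, e). It is
   meaningful only if A is nonsingular; otherwise mat_inverse A = None. *)
definition quasi_det :: "complex Matrix.mat \<Rightarrow> complex" where
  "quasi_det M =
     (case split_block M (dim_row M - 1) (dim_col M - 1) of
        (A, b, c, e) \<Rightarrow> (e - c * the (mat_inverse A) * b) $$ (0, 0))"

end

theory Submission
  imports Defs
begin

text \<open>
  Everything rests on two facts: the jet at the roots of \<open>W\<close> is linear, and on polynomials it vanishes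
  exactly on the multiples of \<open>W\<close> (\<open>jet_vanishes_iff_dvd\<close>). Write \<open>P\<^sub>k\<close>, \<open>Q\<^sub>k\<close>, \<open>H\<^sub>k\<close> for the biorthogonal
  polynomials and norms of \<open>u\<close>, mark those of the perturbed kernel with a prime, and let \<open>A\<close> be the square
  matrix of the jets of \<open>P\<^sub>n, ..., P\<^sub>n\<^sub>+\<^sub>N\<^sub>-\<^sub>1\<close>. Since \<open>\<langle>P, Q\<rangle>\<close> for the perturbed kernel is \<open>\<langle>W P, Q\<rangle>\<close> for \<open>u\<close>,
  orthogonality transfers between the two kernels by multiplication with \<open>W\<close>.

  Nonsingularity of \<open>A\<close> (\<open>multiple_in_window_is_zero\<close>). A combination of \<open>P\<^sub>n, ..., P\<^sub>n\<^sub>+\<^sub>N\<^sub>-\<^sub>1\<close> with zero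
  jet has the form \<open>W T\<close> with \<open>deg T < n\<close>, and \<open>T\<close> is orthogonal for the perturbed kernel to every
  polynomial of degree below \<open>n\<close>. Quasi-definiteness of that kernel forces \<open>T = 0\<close>.

  First family and norms (\<open>connection_formula\<close>). The polynomial \<open>W P'\<^sub>n\<close> is monic of degree \<open>n + N\<close> and
  orthogonal to \<open>1, ..., y\<^sup>n\<^sup>-\<^sup>1\<close>, so it equals \<open>P\<^sub>n\<^sub>+\<^sub>N + \<Sum>\<^sub>i q\<^sub>i P\<^sub>n\<^sub>+\<^sub>i\<close> with \<open>i\<close> running over \<open>0, ..., N - 1\<close>;
  pairing with \<open>Q\<^sub>n\<close> gives \<open>q\<^sub>0 H\<^sub>n = H'\<^sub>n\<close>. Taking jets yields a linear system with matrix \<open>A\<close> that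
  determines the \<open>q\<^sub>i\<close>, and a last quasi-determinant is precisely the elimination of such coefficients.

  Second family (\<open>biorth2_perturbed_as_functional_of_kernel\<close>). Let \<open>L\<close> be the linear functional of the
  jet with \<open>L P\<^sub>n = H\<^sub>n\<close> and \<open>L P\<^sub>k = 0\<close> for \<open>n < k < n + N\<close>; it exists because \<open>A\<close> is invertible.
  Applied to \<open>K\<^sub>n(\<cdot>, y)\<close> it gives a polynomial in \<open>y\<close> that is monic of degree \<open>n\<close>, and whose \<open>u\<close>-pairing
  with a polynomial \<open>F\<close> of degree below \<open>n + N\<close> is \<open>L F\<close>. For \<open>F = W T\<close> this is \<open>0\<close>, so the
  result is orthogonal for the perturbed kernel to all \<open>T\<close> of degree below \<open>n\<close> and must be \<open>Q'\<^sub>n\<close>.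

  All orthogonality arguments need the Gauss--Borel factorization to exist and to be unique, which is
  derived from the nonvanishing of the minors (\<open>gauss_borel_factors\<close>).
\<close>

section \<open>Square systems and bordered determinants\<close>

lemma nonsingular_two_sided_inverse:
  fixes A :: "nat \<Rightarrow> nat \<Rightarrow> complex"
  assumes "Determinant.det (Matrix.mat n n (\<lambda>(i, j). A i j)) \<noteq> 0"
  obtains B where
    "\<And>i j. i < n \<Longrightarrow> j < n \<Longrightarrow> (\<Sum>k<n. A i k * B k j) = (if i = j then 1 else 0)"
    "\<And>i j. i < n \<Longrightarrow> j < n \<Longrightarrow> (\<Sum>k<n. B i k * A k j) = (if i = j then 1 else 0)"
proof -
  let ?M = "Matrix.mat n n (\<lambda>(i, j). A i j)"
  have M: "?M \<in> carrier_mat n n" by simp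
  from det_non_zero_imp_unit[OF M assms, of "()"]
  obtain B where B: "B \<in> carrier_mat n n" "?M * B = 1\<^sub>m n" "B * ?M = 1\<^sub>m n"
    unfolding Units_def by (auto simp: ring_mat_def)
  show thesis
  proof (rule that[of "\<lambda>i j. B $$ (i, j)"])
    fix i j assume ij: "i < n" "j < n"
    have "(?M * B) $$ (i, j) = (\<Sum>k<n. A i k * B $$ (k, j))"
      using ij B(1) by (simp add: scalar_prod_def lessThan_atLeast0)
    then show "(\<Sum>k<n. A i k * B $$ (k, j)) = (if i = j then 1 else 0)"
      using B(2) ij by simp
    have "(B * ?M) $$ (i, j) = (\<Sum>k<n. B $$ (i, k) * A k j)"
      using ij B(1) by (simp add: scalar_prod_def lessThan_atLeast0)
    then show "(\<Sum>k<n. B $$ (i, k) * A k j) = (if i = j then 1 else 0)"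
      using B(3) ij by simp
  qed
qed

lemma sum_mult_delta:
  fixes c :: "nat \<Rightarrow> complex"
  assumes "l < n"
  shows "(\<Sum>k<n. c k * (if k = l then 1 else 0)) = c l"
  using assms by (simp add: if_distrib[where f="\<lambda>x. _ * x"] cong: if_cong)

lemma nonsingular_row_system_solvable:
  fixes A :: "nat \<Rightarrow> nat \<Rightarrow> complex"
  assumes "Determinant.det (Matrix.mat n n (\<lambda>(i, j). A i j)) \<noteq> 0"
  obtains v where "\<And>l. l < n \<Longrightarrow> (\<Sum>k<n. v k * A k l) = c l"
proof -
  obtain B where B: "\<And>i j. i < n \<Longrightarrow> j < n \<Longrightarrow>
      (\<Sum>k<n. B i k * A k j) = (if i = j then 1 else 0)"
    using nonsingular_two_sided_inverse[OF assms] by metis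
  show thesis
  proof (rule that[of "\<lambda>k. \<Sum>i<n. c i * B i k"])
    fix l assume l: "l < n"
    have "(\<Sum>k<n. (\<Sum>i<n. c i * B i k) * A k l) = (\<Sum>k<n. \<Sum>i<n. c i * (B i k * A k l))"
      by (simp add: sum_distrib_right mult.assoc)
    also have "\<dots> = (\<Sum>i<n. c i * (\<Sum>k<n. B i k * A k l))"
      by (subst sum.swap) (simp add: sum_distrib_left)
    also have "\<dots> = (\<Sum>i<n. c i * (if i = l then 1 else 0))"
      using l B by simp
    finally show "(\<Sum>k<n. (\<Sum>i<n. c i * B i k) * A k l) = c l"
      using l by (simp only: sum_mult_delta)
  qed
qed

lemma nonsingular_left_kernel_trivial:
  fixes A :: "nat \<Rightarrow> nat \<Rightarrow> complex"
  assumes "Determinant.det (Matrix.mat n n (\<lambda>(i, j). A i j)) \<noteq> 0"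
    and v: "\<And>l. l < n \<Longrightarrow> (\<Sum>k<n. v k * A k l) = 0"
    and "j < n"
  shows "v j = 0"
proof -
  obtain B where B: "\<And>i j. i < n \<Longrightarrow> j < n \<Longrightarrow>
      (\<Sum>k<n. A i k * B k j) = (if i = j then 1 else 0)"
    using nonsingular_two_sided_inverse[OF assms(1)] by metis
  have "v j = (\<Sum>i<n. v i * (\<Sum>k<n. A i k * B k j))"
    using \<open>j < n\<close> B by (simp add: sum_mult_delta)
  also have "\<dots> = (\<Sum>i<n. \<Sum>k<n. v i * A i k * B k j)"
    by (simp add: sum_distrib_left mult.assoc)
  also have "\<dots> = (\<Sum>k<n. (\<Sum>i<n. v i * A i k) * B k j)"
    by (subst sum.swap) (simp add: sum_distrib_right)
  also have "\<dots> = 0" using v by simp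
  finally show ?thesis .
qed

lemma invertible_mat_inverse:
  fixes A :: "complex Matrix.mat"
  assumes A: "A \<in> carrier_mat N N" and inv: "invertible_mat A"
  obtains B where "mat_inverse A = Some B" "B \<in> carrier_mat N N" "A * B = 1\<^sub>m N" "B * A = 1\<^sub>m N"
proof (cases "mat_inverse A")
  case (Some B)
  then show thesis using mat_inverse(2)[OF A Some] that by blast
next
  case None
  from inv obtain C where C: "A * C = 1\<^sub>m N" "C * A = 1\<^sub>m (dim_row C)"
    using A unfolding invertible_mat_def inverts_mat_def by auto
  then have "C \<in> carrier_mat N N"
    using A by (metis carrier_matD(2) carrier_matI index_mult_mat(2,3) index_one_mat(2,3))
  then have "A \<in> Units (ring_mat TYPE(complex) N ())"
    using A C unfolding Units_def by (auto simp: ring_mat_def)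
  then show thesis using mat_inverse(1)[OF A None, of "()"] by blast
qed

lemma quasi_det_of_blocks:
  fixes R :: "nat \<Rightarrow> complex list"
  assumes len: "\<And>k. length (R k) = N" and c: "length c = N"
    and inv: "mat_inverse (mat_of_rows_list N (map R [n..<n + N])) = Some B"
    and B: "B \<in> carrier_mat N N"
  shows "quasi_det (mat_of_rows_list (N + 1) (map (\<lambda>k. R k @ [b k]) [n..<n + N] @ [c @ [e]]))
         = e - (\<Sum>j<N. (\<Sum>i<N. c ! i * B $$ (i, j)) * b (n + j))"
proof -
  let ?M = "mat_of_rows_list (N + 1) (map (\<lambda>k. R k @ [b k]) [n..<n + N] @ [c @ [e]])"
  let ?A = "mat_of_rows_list N (map R [n..<n + N])"
  have split: "split_block ?M N N =
    (?A, Matrix.mat N 1 (\<lambda>(i, j). b (n + i)), Matrix.mat 1 N (\<lambda>(i, j). c ! j),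
      Matrix.mat 1 1 (\<lambda>(i, j). e))"
    unfolding split_block_def Let_def mat_of_rows_list_def
    by (auto simp: nth_append len c intro!: eq_matI)
  have dims: "dim_row ?M - 1 = N" "dim_col ?M - 1 = N"
    by (simp_all add: mat_of_rows_list_def)
  show ?thesis
    unfolding quasi_det_def dims split
    using B by (simp add: inv scalar_prod_def lessThan_atLeast0)
qed

text \<open>
  With \<open>z = A\<^sup>-\<^sup>1 b\<close> kept as an unknown of a linear system, the bottom row of the bordered matrix can be
  varied independently. The rows are indexed from \<open>n\<close>, as are the windows of consecutive polynomials
  to which this is applied.
\<close>
lemma quasi_det_by_column_relation:
  fixes R :: "nat \<Rightarrow> complex list"
  assumes len: "\<And>k. length (R k) = N"
    and inv: "invertible_mat (mat_of_rows_list N (map R [n..<n + N]))"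
  obtains z where
    "\<And>i. i < N \<Longrightarrow> (\<Sum>j<N. R (n + i) ! j * z j) = b (n + i)"
    "\<And>c e. length c = N \<Longrightarrow>
       quasi_det (mat_of_rows_list (N + 1) (map (\<lambda>k. R k @ [b k]) [n..<n + N] @ [c @ [e]]))
       = e - (\<Sum>j<N. c ! j * z j)"
proof -
  let ?A = "mat_of_rows_list N (map R [n..<n + N])"
  have A: "?A \<in> carrier_mat N N" by (simp add: mat_of_rows_list_def)
  from invertible_mat_inverse[OF A inv] obtain B where B: "mat_inverse ?A = Some B"
    "B \<in> carrier_mat N N" "?A * B = 1\<^sub>m N" by metis
  have AB: "(\<Sum>k<N. R (n + i) ! k * B $$ (k, j)) = (if i = j then 1 else 0)"
    if ij: "i < N" "j < N" for i j
  proof -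
    have "(?A * B) $$ (i, j) = (\<Sum>k<N. R (n + i) ! k * B $$ (k, j))"
      using ij B(2) by (simp add: scalar_prod_def lessThan_atLeast0 mat_of_rows_list_def)
    then show ?thesis using B(3) ij by simp
  qed
  show thesis
  proof (rule that[of "\<lambda>j. \<Sum>k<N. B $$ (j, k) * b (n + k)"])
    fix i assume i: "i < N"
    have "(\<Sum>j<N. R (n + i) ! j * (\<Sum>k<N. B $$ (j, k) * b (n + k)))
      = (\<Sum>j<N. \<Sum>k<N. b (n + k) * (R (n + i) ! j * B $$ (j, k)))"
      by (simp add: sum_distrib_left mult_ac)
    also have "\<dots> = (\<Sum>k<N. b (n + k) * (\<Sum>j<N. R (n + i) ! j * B $$ (j, k)))"
      by (subst sum.swap) (simp add: sum_distrib_left)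
    also have "\<dots> = (\<Sum>k<N. b (n + k) * (if k = i then 1 else 0))"
      using i AB by (intro sum.cong) auto
    finally show "(\<Sum>j<N. R (n + i) ! j * (\<Sum>k<N. B $$ (j, k) * b (n + k))) = b (n + i)"
      using i by (simp only: sum_mult_delta[of i N "\<lambda>k. b (n + k)"])
  next
    fix c :: "complex list" and e assume c: "length c = N"
    have "(\<Sum>j<N. (\<Sum>i<N. c ! i * B $$ (i, j)) * b (n + j))
      = (\<Sum>j<N. \<Sum>i<N. c ! i * (B $$ (i, j) * b (n + j)))"
      by (simp add: sum_distrib_right mult.assoc)
    also have "\<dots> = (\<Sum>i<N. c ! i * (\<Sum>j<N. B $$ (i, j) * b (n + j)))"
      by (subst sum.swap) (simp add: sum_distrib_left)
    finally show "quasi_det (mat_of_rows_list (N + 1) (map (\<lambda>k. R k @ [b k]) [n..<n + N] @ [c @ [e]]))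
       = e - (\<Sum>j<N. c ! j * (\<Sum>k<N. B $$ (j, k) * b (n + k)))"
      by (simp add: quasi_det_of_blocks[OF len c B(1,2), simplified])
  qed
qed

text \<open>
  The same elimination from the left: \<open>c A\<^sup>-\<^sup>1\<close> is the vector \<open>w\<close> expressing the bottom row through the
  rows above it.
\<close>
lemma quasi_det_by_row_relation:
  fixes R :: "nat \<Rightarrow> complex list"
  assumes len: "\<And>k. length (R k) = N" and c: "length c = N"
    and inv: "invertible_mat (mat_of_rows_list N (map R [n..<n + N]))"
    and w: "\<And>j. j < N \<Longrightarrow> c ! j = (\<Sum>i<N. w i * R (n + i) ! j)"
  shows "quasi_det (mat_of_rows_list (N + 1) (map (\<lambda>k. R k @ [b k]) [n..<n + N] @ [c @ [e]]))
         = e - (\<Sum>i<N. w i * b (n + i))"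
proof (rule quasi_det_by_column_relation[OF len inv, of b])
  fix z
  assume z: "\<And>i. i < N \<Longrightarrow> (\<Sum>j<N. R (n + i) ! j * z j) = b (n + i)"
    and qd: "\<And>c e. length c = N \<Longrightarrow>
       quasi_det (mat_of_rows_list (N + 1) (map (\<lambda>k. R k @ [b k]) [n..<n + N] @ [c @ [e]]))
       = e - (\<Sum>j<N. c ! j * z j)"
  have "(\<Sum>j<N. c ! j * z j) = (\<Sum>j<N. \<Sum>i<N. w i * (R (n + i) ! j * z j))"
    by (simp add: w sum_distrib_right mult.assoc)
  also have "\<dots> = (\<Sum>i<N. w i * (\<Sum>j<N. R (n + i) ! j * z j))"
    by (subst sum.swap) (simp add: sum_distrib_left)
  finally show ?thesis
    by (simp add: z qd[OF c, simplified])
qed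

lemma invertible_mat_if_left_kernel_trivial:
  fixes R :: "nat \<Rightarrow> complex list"
  assumes inj: "\<And>v. (\<And>j. j < N \<Longrightarrow> (\<Sum>i<N. v i * R (n + i) ! j) = 0) \<Longrightarrow> (\<forall>i<N. v i = 0)"
  shows "invertible_mat (mat_of_rows_list N (map R [n..<n + N]))"
proof -
  let ?A = "mat_of_rows_list N (map R [n..<n + N])"
  have A: "?A \<in> carrier_mat N N" by (simp add: mat_of_rows_list_def)
  have "Determinant.det (?A\<^sup>T) \<noteq> 0"
  proof
    assume "Determinant.det (?A\<^sup>T) = 0"
    then obtain v where v: "v \<in> carrier_vec N" "v \<noteq> 0\<^sub>v N" "?A\<^sup>T *\<^sub>v v = 0\<^sub>v N"
      using det_0_iff_vec_prod_zero_field[of "?A\<^sup>T" N] A by auto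
    have "(\<Sum>i<N. v $ i * R (n + i) ! j) = 0" if j: "j < N" for j
    proof -
      have "(?A\<^sup>T *\<^sub>v v) $ j = (\<Sum>i<N. R (n + i) ! j * v $ i)"
        using j v(1) by (simp add: scalar_prod_def lessThan_atLeast0 mat_of_rows_list_def)
      then show ?thesis using v(3) j by (simp add: mult.commute)
    qed
    then have "\<forall>i<N. v $ i = 0" by (rule inj)
    then show False using v(1,2) by auto
  qed
  then have "Determinant.det ?A \<noteq> 0"
    using A by (simp add: det_transpose)
  from det_non_zero_imp_unit[OF A this, of "()"]
  obtain B where "B \<in> carrier_mat N N" "?A * B = 1\<^sub>m N" "B * ?A = 1\<^sub>m N"
    unfolding Units_def by (auto simp: ring_mat_def)
  then show ?thesis using A unfolding invertible_mat_def inverts_mat_def by auto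
qed

section \<open>The Gauss--Borel factorization\<close>

lemma lower_times_assoc:
  assumes "\<And>k l. k < l \<Longrightarrow> B k l = 0"
  shows "lower_times A (lower_times B G) = lower_times (lower_times A B) G"
proof (intro ext)
  fix i j
  have "lower_times A (lower_times B G) i j = (\<Sum>k\<le>i. \<Sum>l\<le>k. A i k * (B k l * G l j))"
    by (simp add: lower_times_def sum_distrib_left)
  also have "\<dots> = (\<Sum>k\<le>i. \<Sum>l\<le>i. A i k * (B k l * G l j))"
    using assms by (intro sum.cong refl sum.mono_neutral_left) auto
  also have "\<dots> = (\<Sum>l\<le>i. \<Sum>k\<le>i. A i k * B k l * G l j)"
    by (subst sum.swap) (simp add: mult.assoc)
  finally show "lower_times A (lower_times B G) i j = lower_times (lower_times A B) G i j"
    by (simp add: lower_times_def sum_distrib_right)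
qed

lemma lower_times_identity_left [simp]: "lower_times (diag_si (\<lambda>_. 1)) A = A"
  by (intro ext) (simp add: lower_times_def diag_si_def if_distrib[where f="\<lambda>x. x * _"] cong: if_cong)

lemma lower_times_identity_right:
  assumes "lower_unitriangular A"
  shows "lower_times A (diag_si (\<lambda>_. 1)) = A"
  using assms
  by (intro ext) (auto simp: lower_times_def diag_si_def lower_unitriangular_def
      if_distrib[where f="\<lambda>x. _ * x"] cong: if_cong)

lemma lower_times_transpose_commute:
  "lower_times A (transpose_si (lower_times B (transpose_si G)))
   = transpose_si (lower_times B (transpose_si (lower_times A G)))"
proof (intro ext)
  fix i j
  have "(\<Sum>k\<le>i. A i k * (\<Sum>l\<le>j. B j l * G k l)) = (\<Sum>l\<le>j. B j l * (\<Sum>k\<le>i. A i k * G k l))"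
    unfolding sum_distrib_left by (subst sum.swap) (simp add: mult_ac)
  then show "lower_times A (transpose_si (lower_times B (transpose_si G))) i j
    = transpose_si (lower_times B (transpose_si (lower_times A G))) i j"
    by (simp add: lower_times_def transpose_si_def)
qed

lemma transpose_si_transpose_si [simp]: "transpose_si (transpose_si A) = A"
  by (simp add: transpose_si_def)

lemma transpose_si_diag_si [simp]: "transpose_si (diag_si h) = diag_si h"
  by (intro ext) (auto simp: transpose_si_def diag_si_def)

text \<open>The inverse of \<open>S\<close>, row by row by forward substitution.\<close>

fun lower_solution :: "semi_inf_mat \<Rightarrow> nat \<Rightarrow> nat \<Rightarrow> complex" where
  "lower_solution S i j = (if i = j then 1 else 0) - (\<Sum>k<i. S i k * lower_solution S k j)"

declare lower_solution.simps [simp del]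

lemma lower_solution_unitriangular: "lower_unitriangular (lower_solution S)"
proof -
  have upper: "lower_solution S i j = 0" if "i < j" for i j
    using that
  proof (induction i rule: less_induct)
    case (less i)
    then show ?case by (subst lower_solution.simps) simp
  qed
  have "lower_solution S i i = 1" for i
    by (subst lower_solution.simps) (simp add: upper)
  with upper show ?thesis by (simp add: lower_unitriangular_def)
qed

lemma lower_times_lower_solution:
  assumes "lower_unitriangular S"
  shows "lower_times S (lower_solution S) = diag_si (\<lambda>_. 1)"
proof (intro ext)
  fix i j
  have "lower_times S (lower_solution S) i j
    = (\<Sum>k<i. S i k * lower_solution S k j) + lower_solution S i j"
    using assms by (simp add: lower_times_def lower_unitriangular_def
        lessThan_Suc_atMost[symmetric])
  then show "lower_times S (lower_solution S) i j = diag_si (\<lambda>_. 1) i j"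
    by (subst (asm) lower_solution.simps[of S i j]) (simp add: diag_si_def)
qed

lemma lower_inverse_props:
  assumes S: "lower_unitriangular S"
  shows "lower_unitriangular (lower_inverse S)"
    and "lower_times S (lower_inverse S) = diag_si (\<lambda>_. 1)"
    and "lower_times (lower_inverse S) S = diag_si (\<lambda>_. 1)"
proof -
  let ?T = "lower_solution S"
  let ?U = "lower_solution ?T"
  have zero: "k < l \<Longrightarrow> A k l = 0" if "lower_unitriangular A" for A k l
    using that by (simp add: lower_unitriangular_def)
  have T: "lower_unitriangular ?T" "lower_times S ?T = diag_si (\<lambda>_. 1)"
    using S by (simp_all add: lower_solution_unitriangular lower_times_lower_solution)
  have U: "lower_unitriangular ?U" "lower_times ?T ?U = diag_si (\<lambda>_. 1)"
    using T by (simp_all add: lower_solution_unitriangular lower_times_lower_solution)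
  have "S = lower_times S (lower_times ?T ?U)"
    using S U by (simp add: lower_times_identity_right)
  also have "\<dots> = lower_times (lower_times S ?T) ?U"
    using zero[OF T(1)] by (rule lower_times_assoc)
  finally have "S = ?U" using T(2) by simp
  with U have TS: "lower_times ?T S = diag_si (\<lambda>_. 1)" by simp
  have "\<exists>!T. lower_unitriangular T \<and>
     lower_times S T = diag_si (\<lambda>_. 1) \<and> lower_times T S = diag_si (\<lambda>_. 1)"
  proof (rule ex1I[of _ ?T])
    fix T' assume T': "lower_unitriangular T' \<and>
      lower_times S T' = diag_si (\<lambda>_. 1) \<and> lower_times T' S = diag_si (\<lambda>_. 1)"
    have "?T = lower_times ?T (lower_times S T')"
      using T(1) T' by (simp add: lower_times_identity_right)
    also have "\<dots> = lower_times (lower_times ?T S) T'"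
      using zero[OF S] by (rule lower_times_assoc)
    finally show "T' = ?T" using TS by simp
  qed (use T TS in simp)
  from theI'[OF this] show "lower_unitriangular (lower_inverse S)"
    and "lower_times S (lower_inverse S) = diag_si (\<lambda>_. 1)"
    and "lower_times (lower_inverse S) S = diag_si (\<lambda>_. 1)"
    unfolding lower_inverse_def by blast+
qed

lemma lower_times_inverse_cancel:
  assumes "lower_unitriangular S"
  shows "lower_times S (lower_times (lower_inverse S) A) = A"
    and "lower_times (lower_inverse S) (lower_times S A) = A"
proof -
  note inv = lower_inverse_props[OF assms]
  show "lower_times S (lower_times (lower_inverse S) A) = A"
    by (subst lower_times_assoc) (use inv in \<open>auto simp: lower_unitriangular_def\<close>)
  show "lower_times (lower_inverse S) (lower_times S A) = A"
    by (subst lower_times_assoc) (use assms inv in \<open>auto simp: lower_unitriangular_def\<close>)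
qed

lemma diag_times_transpose:
  assumes "lower_unitriangular L"
  shows "lower_times (diag_si h) (transpose_si L) = transpose_si (lower_times L (diag_si h))"
  using assms
  by (intro ext) (auto simp: lower_times_def transpose_si_def diag_si_def lower_unitriangular_def
      if_distrib[where f="\<lambda>x. x * _"] if_distrib[where f="\<lambda>x. _ * x"] cong: if_cong)

text \<open>
  The factorization means that \<open>S\<^sub>1 G S\<^sub>2\<^sup>T = H\<close>, which is free of inverses and is the form in which
  biorthogonality appears. Products with \<open>S\<^sub>2\<^sup>T\<close> on the right are written with two transpositions
  because only products with a lower triangular left factor are available as finite sums.
\<close>
lemma gauss_borel_iff_diagonalizes:
  assumes S1: "lower_unitriangular S1" and S2: "lower_unitriangular S2"
  shows "gauss_borel G S1 H S2 \<longleftrightarrow>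
    lower_times S1 (transpose_si (lower_times S2 (transpose_si G))) = diag_si H"
proof -
  let ?U = "transpose_si (lower_times (lower_inverse S2) (diag_si H))"
  have "gauss_borel G S1 H S2 \<longleftrightarrow> G = lower_times (lower_inverse S1) ?U"
    using S1 S2 by (simp add: gauss_borel_def diag_times_transpose lower_inverse_props)
  also have "\<dots> \<longleftrightarrow> lower_times S1 G = ?U"
    using S1 by (metis lower_times_inverse_cancel)
  also have "\<dots> \<longleftrightarrow>
    transpose_si (lower_times S1 G) = lower_times (lower_inverse S2) (diag_si H)"
    by (metis transpose_si_transpose_si)
  also have "\<dots> \<longleftrightarrow> lower_times S2 (transpose_si (lower_times S1 G)) = diag_si H"
    using S2 by (metis lower_times_inverse_cancel)
  also have "\<dots> \<longleftrightarrow>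
    lower_times S1 (transpose_si (lower_times S2 (transpose_si G))) = diag_si H"
    unfolding lower_times_transpose_commute by (metis transpose_si_transpose_si transpose_si_diag_si)
  finally show ?thesis .
qed

lemma gauss_borel_transpose:
  assumes "gauss_borel G S1 H S2"
  shows "gauss_borel (transpose_si G) S2 H S1"
proof -
  have S: "lower_unitriangular S1" "lower_unitriangular S2"
    using assms by (simp_all add: gauss_borel_def)
  then have "lower_times S1 (transpose_si (lower_times S2 (transpose_si G))) = diag_si H"
    using assms gauss_borel_iff_diagonalizes by blast
  then have "transpose_si (lower_times S2 (transpose_si (lower_times S1 G))) = diag_si H"
    by (simp only: lower_times_transpose_commute)
  then have "lower_times S2 (transpose_si (lower_times S1 G)) = diag_si H"
    by (metis transpose_si_transpose_si transpose_si_diag_si)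
  then show ?thesis using gauss_borel_iff_diagonalizes[OF S(2,1)] by simp
qed

text \<open>
  Since \<open>S\<^sub>1 G = H S\<^sub>2\<^sup>-\<^sup>T\<close> is upper triangular with diagonal \<open>H\<close>, its entries on and below the diagonal
  are known without reference to \<open>S\<^sub>2\<close>; they give a linear system that determines the rows of \<open>S\<^sub>1\<close>.
\<close>
lemma gauss_borel_row:
  assumes "gauss_borel G S1 H S2" and "l \<le> n"
  shows "(\<Sum>k\<le>n. S1 n k * G k l) = (if l = n then H n else 0)"
proof -
  have S: "lower_unitriangular S1" "lower_unitriangular S2"
    using assms by (simp_all add: gauss_borel_def)
  have "lower_times S1 G = lower_times (diag_si H) (transpose_si (lower_inverse S2))"
    using assms(1) S by (simp add: gauss_borel_def lower_times_inverse_cancel)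
  then have "lower_times S1 G n l = lower_times (diag_si H) (transpose_si (lower_inverse S2)) n l"
    by simp
  also have "\<dots> = H n * lower_inverse S2 l n"
    by (simp add: lower_times_def diag_si_def transpose_si_def
        if_distrib[where f="\<lambda>x. x * _"] cong: if_cong)
  finally show ?thesis
    using lower_inverse_props(1)[OF S(2)] assms(2)
    by (auto simp: lower_times_def lower_unitriangular_def)
qed

text \<open>
  The minor of size \<open>0\<close> is \<open>1\<close>, so including it costs nothing and removes a case distinction. Working
  with a matrix instead of a kernel makes transposition available.
\<close>

definition nonzero_minors :: "semi_inf_mat \<Rightarrow> bool" where
  "nonzero_minors G \<longleftrightarrow> (\<forall>k. Determinant.det (Matrix.mat k k (\<lambda>(i, j). G i j)) \<noteq> 0)"

lemma quasi_definite_iff_nonzero_minors: "quasi_definite u \<longleftrightarrow> nonzero_minors (gram u)"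
proof -
  have "Determinant.det (Matrix.mat 0 0 (\<lambda>(i, j). gram u i j)) \<noteq> 0"
    by (subst det_dim_zero) auto
  then show ?thesis
    unfolding quasi_definite_def nonzero_minors_def
    by (metis One_nat_def Suc_leI bot_nat_0.not_eq_extremum)
qed

lemma nonzero_minors_transpose:
  assumes "nonzero_minors G"
  shows "nonzero_minors (transpose_si G)"
proof -
  have "Matrix.mat k k (\<lambda>(i, j). transpose_si G i j) = (Matrix.mat k k (\<lambda>(i, j). G i j))\<^sup>T" for k
    by (auto simp: transpose_si_def intro!: eq_matI)
  then show ?thesis
    using assms unfolding nonzero_minors_def by (metis det_transpose mat_carrier)
qed

lemma nonzero_minors_left_kernel:
  assumes "nonzero_minors G" and "\<And>l. l < n \<Longrightarrow> (\<Sum>k<n. v k * G k l) = 0" and "j < n"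
  shows "v j = 0"
  using assms nonsingular_left_kernel_trivial[of n G v j] by (auto simp: nonzero_minors_def)

text \<open>
  Two candidate rows have the same last entry \<open>1\<close>, so their difference lies in the left kernel of a
  nonsingular leading block. Uniqueness of \<open>S\<^sub>2\<close> is the same statement for the transposed matrix.
\<close>
lemma gauss_borel_unique_left:
  assumes G: "nonzero_minors G"
    and g: "gauss_borel G S1 H S2" and g': "gauss_borel G S1' H' S2'"
  shows "S1 = S1'" and "H = H'"
proof -
  have S: "lower_unitriangular S1" "lower_unitriangular S1'"
    using g g' by (simp_all add: gauss_borel_def)
  have eq: "S1 n j = S1' n j" if j: "j < n" for n j
  proof -
    have "S1 n j - S1' n j = 0"
    proof (rule nonzero_minors_left_kernel[OF G, of n "\<lambda>j. S1 n j - S1' n j" j])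
      fix l assume l: "l < n"
      have "(\<Sum>k<Suc n. (S1 n k - S1' n k) * G k l) = 0"
        using gauss_borel_row[OF g, of l n] gauss_borel_row[OF g', of l n] l
        by (simp only: lessThan_Suc_atMost) (simp add: left_diff_distrib sum_subtractf)
      then show "(\<Sum>k<n. (S1 n k - S1' n k) * G k l) = 0"
        using S by (simp add: lower_unitriangular_def)
    qed (use j in simp)
    then show ?thesis by simp
  qed
  show "S1 = S1'"
  proof (intro ext)
    fix n j
    show "S1 n j = S1' n j"
      using S eq by (cases j n rule: linorder_cases) (auto simp: lower_unitriangular_def)
  qed
  then show "H = H'"
    using gauss_borel_row[OF g, of n n for n] gauss_borel_row[OF g', of n n for n]
    by (intro ext) simp
qed

text \<open>
  Row \<open>n\<close> is \<open>(v, 1)\<close> with \<open>v\<close> solving a system whose matrix is the leading block of size \<open>n\<close>.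
\<close>
lemma orthogonal_rows_exist:
  assumes "nonzero_minors G"
  obtains S where "lower_unitriangular S"
    "\<And>n l. l < n \<Longrightarrow> (\<Sum>k\<le>n. S n k * G k l) = 0"
proof -
  have "\<exists>v. \<forall>l<n. (\<Sum>k<n. v k * G k l) = - G n l" for n
    using nonsingular_row_system_solvable[of n G "\<lambda>l. - G n l"] assms
    unfolding nonzero_minors_def by metis
  then obtain v where v: "\<And>n l. l < n \<Longrightarrow> (\<Sum>k<n. v n k * G k l) = - G n l"
    by metis
  let ?S = "\<lambda>n k. if k < n then v n k else if k = n then 1 else 0"
  show thesis
  proof (rule that[of ?S])
    show "lower_unitriangular ?S" by (simp add: lower_unitriangular_def)
    fix n l :: nat assume "l < n"
    then show "(\<Sum>k\<le>n. ?S n k * G k l) = 0"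
      using v by (simp add: lessThan_Suc_atMost[symmetric])
  qed
qed

text \<open>
  The rows orthogonalized from the left and the columns orthogonalized from the right annihilate,
  respectively, the part of \<open>S\<^sub>1 G S\<^sub>2\<^sup>T\<close> below and the part above the diagonal.
\<close>
lemma gauss_borel_exists:
  assumes "nonzero_minors G"
  obtains S1 H S2 where "gauss_borel G S1 H S2"
proof -
  obtain S1 where S1: "lower_unitriangular S1"
    "\<And>n l. l < n \<Longrightarrow> (\<Sum>k\<le>n. S1 n k * G k l) = 0"
    using orthogonal_rows_exist[OF assms] by metis
  obtain S2 where S2: "lower_unitriangular S2"
    "\<And>n l. l < n \<Longrightarrow> (\<Sum>k\<le>n. S2 n k * G l k) = 0"
    using orthogonal_rows_exist[OF nonzero_minors_transpose[OF assms]]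
    unfolding transpose_si_def by metis
  let ?D = "lower_times S1 (transpose_si (lower_times S2 (transpose_si G)))"
  have "?D i j = 0" if "i < j" for i j
    using that S2(2) by (simp add: lower_times_def transpose_si_def)
  moreover have "?D i j = 0" if "j < i" for i j
    unfolding lower_times_transpose_commute
    using that S1(2) by (simp add: lower_times_def transpose_si_def)
  ultimately have "?D = diag_si (\<lambda>i. ?D i i)"
    by (intro ext) (metis diag_si_def linorder_neqE_nat)
  then show thesis
    using that gauss_borel_iff_diagonalizes[OF S1(1) S2(1)] by blast
qed

lemma gauss_borel_factors:
  assumes "quasi_definite u"
  shows "gauss_borel (gram u) (factor_S1 u) (factor_H u) (factor_S2 u)"
proof -
  have G: "nonzero_minors (gram u)"
    using assms by (simp add: quasi_definite_iff_nonzero_minors)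
  obtain S1 H S2 where g: "gauss_borel (gram u) S1 H S2"
    using gauss_borel_exists[OF G] by metis
  have "factors u = (S1, H, S2)"
    unfolding factors_def
  proof (rule the_equality)
    show "case (S1, H, S2) of (S1, H, S2) \<Rightarrow> gauss_borel (gram u) S1 H S2"
      using g by simp
  next
    fix t assume "case t of (S1, H, S2) \<Rightarrow> gauss_borel (gram u) S1 H S2"
    then obtain S1' H' S2' where t: "t = (S1', H', S2')" and g': "gauss_borel (gram u) S1' H' S2'"
      by (cases t) auto
    show "t = (S1, H, S2)"
      using gauss_borel_unique_left[OF G g' g]
        gauss_borel_unique_left(1)[OF nonzero_minors_transpose[OF G]
          gauss_borel_transpose[OF g'] gauss_borel_transpose[OF g]]
      by (simp add: t)
  qed
  then show ?thesis
    using g by (simp add: factor_S1_def factor_H_def factor_S2_def)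
qed

text \<open>
  If \<open>H\<^sub>n\<close> were zero, row \<open>n\<close> of \<open>S\<^sub>1\<close> would lie in the left kernel of the leading block of size \<open>n + 1\<close>.
\<close>
lemma factor_H_nonzero:
  assumes "quasi_definite u"
  shows "factor_H u n \<noteq> 0"
proof
  assume "factor_H u n = 0"
  then have "\<And>l. l < Suc n \<Longrightarrow> (\<Sum>k<Suc n. factor_S1 u n k * gram u k l) = 0"
    using gauss_borel_row[OF gauss_borel_factors[OF assms], of _ n]
    by (simp only: lessThan_Suc_atMost) (auto simp: less_Suc_eq_le)
  then have "factor_S1 u n n = 0"
    using nonzero_minors_left_kernel[of "gram u" "Suc n" "factor_S1 u n" n] assms
    by (simp add: quasi_definite_iff_nonzero_minors)
  then show False
    using gauss_borel_factors[OF assms] by (simp add: gauss_borel_def lower_unitriangular_def)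
qed

section \<open>Biorthogonal polynomials\<close>

lemma
  assumes "generalized_kernel u"
  shows generalized_kernel_add: "u (p + q) = u p + u q"
    and generalized_kernel_smult: "u (smult [:c:] p) = c * u p"
  using assms by (simp_all add: generalized_kernel_def Vector_Spaces.linear_iff)

lemma generalized_kernel_perturbed:
  assumes "generalized_kernel u"
  shows "generalized_kernel (perturbed_kernel W u)"
  using assms
  by (simp add: generalized_kernel_def Vector_Spaces.linear_iff perturbed_kernel_def
      distrib_left)

lemma kernel_form_perturbed:
  "kernel_form (perturbed_kernel W u) P Q = kernel_form u (W * P) Q"
  by (simp add: kernel_form_def perturbed_kernel_def in_x_def mult.assoc[symmetric])

lemma in_y_add: "in_y (P + Q) = in_y P + in_y Q"
  unfolding in_y_def by (rule poly_eqI) (simp add: coeff_map_poly)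

lemma in_y_smult: "in_y (smult c P) = smult [:c:] (in_y P)"
  unfolding in_y_def by (rule poly_eqI) (simp add: coeff_map_poly)

lemma
  assumes u: "generalized_kernel u"
  shows kernel_form_add_left: "kernel_form u (P + Q) R = kernel_form u P R + kernel_form u Q R"
    and kernel_form_add_right: "kernel_form u R (P + Q) = kernel_form u R P + kernel_form u R Q"
    and kernel_form_smult_left: "kernel_form u (smult c P) R = c * kernel_form u P R"
    and kernel_form_smult_right: "kernel_form u R (smult c P) = c * kernel_form u R P"
proof -
  have "in_x (P + Q) * in_y R = in_x P * in_y R + in_x Q * in_y R"
    by (simp add: in_x_def smult_add_left)
  then show "kernel_form u (P + Q) R = kernel_form u P R + kernel_form u Q R"
    unfolding kernel_form_def by (simp add: generalized_kernel_add[OF u])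
  show "kernel_form u R (P + Q) = kernel_form u R P + kernel_form u R Q"
    unfolding kernel_form_def by (simp add: in_y_add distrib_left generalized_kernel_add[OF u])
  have "in_x (smult c P) * in_y R = smult [:c:] (in_x P * in_y R)"
    by (simp add: in_x_def)
  then show "kernel_form u (smult c P) R = c * kernel_form u P R"
    unfolding kernel_form_def by (simp add: generalized_kernel_smult[OF u])
  show "kernel_form u R (smult c P) = c * kernel_form u R P"
    unfolding kernel_form_def by (simp add: in_y_smult generalized_kernel_smult[OF u])
qed

lemma
  assumes u: "generalized_kernel u"
  shows kernel_form_0_left: "kernel_form u 0 R = 0"
    and kernel_form_0_right: "kernel_form u R 0 = 0"
  using kernel_form_smult_left[OF u, of 0 0 R] kernel_form_smult_right[OF u, of R 0 0] by simp_all

lemma kernel_form_sum_left: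
  assumes u: "generalized_kernel u"
  shows "kernel_form u (\<Sum>k\<in>A. smult (c k) (P k)) R = (\<Sum>k\<in>A. c k * kernel_form u (P k) R)"
  by (induction A rule: infinite_finite_induct)
    (simp_all add: kernel_form_0_left[OF u] kernel_form_add_left[OF u] kernel_form_smult_left[OF u])

lemma kernel_form_sum_right:
  assumes u: "generalized_kernel u"
  shows "kernel_form u R (\<Sum>k\<in>A. smult (c k) (P k)) = (\<Sum>k\<in>A. c k * kernel_form u R (P k))"
  by (induction A rule: infinite_finite_induct)
    (simp_all add: kernel_form_0_right[OF u] kernel_form_add_right[OF u] kernel_form_smult_right[OF u])

text \<open>
  Coefficients are used instead of degrees because they behave well under sums and need no separate
  treatment of the zero polynomial.
\<close>
definition monic_basis :: "(nat \<Rightarrow> complex poly) \<Rightarrow> bool" where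
  "monic_basis P \<longleftrightarrow>
    (\<forall>k. Polynomial.coeff (P k) k = 1 \<and> (\<forall>j>k. Polynomial.coeff (P k) j = 0))"

text \<open>
  Subtract the multiple of the top basis element that cancels the top coefficient, and induct.
\<close>
lemma monic_basis_expansion:
  assumes "monic_basis P" and "\<And>j. M \<le> j \<Longrightarrow> Polynomial.coeff Q j = 0"
  obtains q where "Q = (\<Sum>k<M. smult (q k) (P k))"
  using assms(2)
proof (induction M arbitrary: Q thesis)
  case 0
  then show ?case by (metis bot_nat_0.extremum lessThan_0 poly_eqI coeff_0 sum.empty)
next
  case (Suc M)
  let ?c = "Polynomial.coeff Q M"
  have "Polynomial.coeff (Q - smult ?c (P M)) j = 0" if "M \<le> j" for j
    using that assms(1) Suc.prems(2)[of j] by (cases "j = M") (auto simp: monic_basis_def)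
  then obtain q where q: "Q - smult ?c (P M) = (\<Sum>k<M. smult (q k) (P k))"
    using Suc.IH by blast
  then have "Q = (\<Sum>k<Suc M. smult ((q(M := ?c)) k) (P k))"
    by (simp add: algebra_simps)
  then show ?case using Suc.prems(1) by blast
qed

lemma coeff_row_poly: "Polynomial.coeff (row_poly S n) k = (if k \<le> n then S n k else 0)"
  by (simp add: row_poly_def coeff_sum)

lemma monic_basis_row_poly:
  assumes "lower_unitriangular S"
  shows "monic_basis (row_poly S)"
  using assms by (simp add: monic_basis_def coeff_row_poly lower_unitriangular_def)

lemma
  assumes "quasi_definite u"
  shows monic_basis_biorth1: "monic_basis (biorth1 u)"
    and monic_basis_biorth2: "monic_basis (biorth2 u)"
  using gauss_borel_factors[OF assms] monic_basis_row_poly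
  by (auto simp: gauss_borel_def biorth1_def[abs_def] biorth2_def[abs_def])

lemma row_poly_as_combination: "row_poly S n = (\<Sum>k\<le>n. smult (S n k) (monom 1 k))"
  by (simp add: row_poly_def smult_monom)

lemma biorthogonality:
  assumes u: "generalized_kernel u" and q: "quasi_definite u"
  shows "kernel_form u (biorth1 u i) (biorth2 u j) = (if i = j then factor_H u i else 0)"
proof -
  let ?S1 = "factor_S1 u" and ?S2 = "factor_S2 u"
  have "kernel_form u (biorth1 u i) (biorth2 u j)
    = (\<Sum>l\<le>j. ?S2 j l * (\<Sum>k\<le>i. ?S1 i k * gram u k l))"
    by (simp add: biorth1_def biorth2_def row_poly_as_combination gram_def
        kernel_form_sum_left[OF u] kernel_form_sum_right[OF u])
  also have "\<dots> = lower_times ?S1 (transpose_si (lower_times ?S2 (transpose_si (gram u)))) i j"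
    unfolding lower_times_transpose_commute by (simp add: lower_times_def transpose_si_def)
  also have "\<dots> = diag_si (factor_H u) i j"
    using gauss_borel_factors[OF q] gauss_borel_iff_diagonalizes
    by (metis gauss_borel_def)
  finally show ?thesis by (simp add: diag_si_def)
qed

lemma fourier_coefficient1:
  assumes u: "generalized_kernel u" "quasi_definite u" and "finite A"
  shows "kernel_form u (\<Sum>k\<in>A. smult (q k) (biorth1 u k)) (biorth2 u l)
    = (if l \<in> A then q l * factor_H u l else 0)"
  using assms(3)
  by (simp add: kernel_form_sum_left[OF u(1)] biorthogonality[OF u]
      if_distrib[where f="\<lambda>x. _ * x"] cong: if_cong)

lemma fourier_coefficient2:
  assumes u: "generalized_kernel u" "quasi_definite u" and "finite A"
  shows "kernel_form u (biorth1 u l) (\<Sum>k\<in>A. smult (q k) (biorth2 u k))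
    = (if l \<in> A then q l * factor_H u l else 0)"
  using assms(3)
  by (simp add: kernel_form_sum_right[OF u(1)] biorthogonality[OF u]
      if_distrib[where f="\<lambda>x. _ * x"] cong: if_cong)

text \<open>
  Nondegeneracy on polynomials of degree below \<open>n\<close>: the pairings determine the coordinates in the
  biorthogonal basis because the norms are nonzero.
\<close>
lemma orthogonal_low_degree_is_zero:
  assumes u: "generalized_kernel u" "quasi_definite u"
    and deg: "\<And>j. n \<le> j \<Longrightarrow> Polynomial.coeff R j = 0"
    and orth: "\<And>k. k < n \<Longrightarrow> kernel_form u R (biorth2 u k) = 0"
  shows "R = 0"
proof -
  obtain q where q: "R = (\<Sum>k<n. smult (q k) (biorth1 u k))"
    using monic_basis_expansion[OF monic_basis_biorth1[OF u(2)] deg] by metis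
  have "q k = 0" if "k < n" for k
    using orth[OF that] fourier_coefficient1[OF u, of "{..<n}" q k] that factor_H_nonzero[OF u(2), of k]
    by (simp add: q)
  then show ?thesis by (simp add: q)
qed

lemma biorth2_unique:
  assumes u: "generalized_kernel u" "quasi_definite u"
    and monic: "Polynomial.coeff Q n = 1" "\<And>j. n < j \<Longrightarrow> Polynomial.coeff Q j = 0"
    and orth: "\<And>k. k < n \<Longrightarrow> kernel_form u (biorth1 u k) Q = 0"
  shows "Q = biorth2 u n"
proof -
  note basis = monic_basis_biorth2[OF u(2)]
  have "\<And>j. Suc n \<le> j \<Longrightarrow> Polynomial.coeff Q j = 0" using monic(2) by simp
  from monic_basis_expansion[OF basis this] obtain q
    where q: "Q = (\<Sum>k<Suc n. smult (q k) (biorth2 u k))" by metis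
  have "q k = 0" if "k < n" for k
    using orth[OF that] fourier_coefficient2[OF u, of "{..<Suc n}" k q] that factor_H_nonzero[OF u(2), of k]
    unfolding q by simp
  then have "Q = smult (q n) (biorth2 u n)" by (simp add: q)
  then show ?thesis
    using monic(1) basis by (simp add: monic_basis_def)
qed

text \<open>
  The basis need not belong to the kernel at hand. This is what lets orthogonality against the
  polynomials of one kernel be used against those of another.
\<close>
lemma orthogonal_to_low_degree:
  assumes u: "generalized_kernel u" and B: "monic_basis B"
    and orth: "\<And>l. l < n \<Longrightarrow> kernel_form u Q (B l) = 0"
    and deg: "\<And>j. n \<le> j \<Longrightarrow> Polynomial.coeff R j = 0"
  shows "kernel_form u Q R = 0"
proof -
  obtain q where "R = (\<Sum>l<n. smult (q l) (B l))"
    using monic_basis_expansion[OF B deg] by metis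
  then show ?thesis
    using orth by (simp add: kernel_form_sum_right[OF u])
qed

text \<open>
  Two monic polynomials of the same degree differ by something of lower degree, which does not pair.
\<close>
lemma biorth1_pairing_monic:
  assumes u: "generalized_kernel u" "quasi_definite u"
    and monic: "Polynomial.coeff Q n = 1" "\<And>j. n < j \<Longrightarrow> Polynomial.coeff Q j = 0"
  shows "kernel_form u (biorth1 u n) Q = factor_H u n"
proof -
  note basis = monic_basis_biorth2[OF u(2)]
  have "kernel_form u (biorth1 u n) (Q - biorth2 u n) = 0"
  proof (rule orthogonal_to_low_degree[OF u(1) basis])
    show "kernel_form u (biorth1 u n) (biorth2 u l) = 0" if "l < n" for l
      using that by (simp add: biorthogonality[OF u])
    show "Polynomial.coeff (Q - biorth2 u n) j = 0" if "n \<le> j" for j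
      using that monic basis by (cases "j = n") (auto simp: monic_basis_def)
  qed
  then show ?thesis
    using kernel_form_add_right[OF u(1), of "biorth1 u n" "Q - biorth2 u n" "biorth2 u n"]
    by (simp add: biorthogonality[OF u])
qed

section \<open>Multiplying the kernel by a monic polynomial\<close>

text \<open>
  Nonsingularity of the jet matrix in a form that mentions no jets. The quotient by \<open>W\<close> has degree
  below \<open>n\<close>, and inherits from the window orthogonality to all polynomials of degree below \<open>n\<close> with
  respect to the perturbed kernel.
\<close>
lemma multiple_in_window_is_zero:
  assumes u: "generalized_kernel u" "quasi_definite u"
    and uh: "quasi_definite (perturbed_kernel W u)"
    and W: "W \<noteq> 0" "Polynomial.degree W = N"
    and dvd: "W dvd (\<Sum>i<N. smult (v i) (biorth1 u (n + i)))"
    and "i < N"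
  shows "v i = 0"
proof -
  let ?uh = "perturbed_kernel W u"
  have uh: "generalized_kernel ?uh" "quasi_definite ?uh"
    using u uh generalized_kernel_perturbed by simp_all
  define Q where "Q = (\<Sum>i<N. smult (v i) (biorth1 u (n + i)))"
  have Q_shift: "Q = (\<Sum>k\<in>{n..<n + N}. smult (v (k - n)) (biorth1 u k))"
    unfolding Q_def lessThan_atLeast0
    using sum.shift_bounds_nat_ivl[of "\<lambda>k. smult (v (k - n)) (biorth1 u k)" 0 n N]
    by (simp add: add.commute)
  have pairing: "kernel_form u Q (biorth2 u l) = (if l \<in> {n..<n + N} then v (l - n) * factor_H u l else 0)" for l
    unfolding Q_shift by (rule fourier_coefficient1[OF u]) simp
  obtain T where T: "Q = W * T"
    using dvd by (auto simp: Q_def elim: dvdE)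
  have degQ: "Polynomial.coeff Q j = 0" if "n + N \<le> j" for j
    using that monic_basis_biorth1[OF u(2)] by (simp add: Q_def coeff_sum monic_basis_def)
  have "T = 0"
  proof (rule ccontr)
    assume "T \<noteq> 0"
    then have "Polynomial.degree Q = N + Polynomial.degree T" "Q \<noteq> 0"
      using W by (simp_all add: T degree_mult_eq)
    then have degT: "Polynomial.degree T < n"
      using degQ[of "Polynomial.degree Q"] leading_coeff_0_iff[of Q]
      by (cases "Polynomial.degree T < n") simp_all
    have "T = 0"
    proof (rule orthogonal_low_degree_is_zero[OF uh, of n])
      show "Polynomial.coeff T j = 0" if "n \<le> j" for j
        using that degT by (simp add: coeff_eq_0)
      fix k assume k: "k < n"
      have "kernel_form u Q (biorth2 ?uh k) = 0"
      proof (rule orthogonal_to_low_degree[OF u(1) monic_basis_biorth2[OF u(2)], of n])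
        show "kernel_form u Q (biorth2 u l) = 0" if "l < n" for l
          using that by (simp add: pairing)
        show "Polynomial.coeff (biorth2 ?uh k) j = 0" if "n \<le> j" for j
          using that k monic_basis_biorth2[OF uh(2)] by (simp add: monic_basis_def)
      qed
      then show "kernel_form ?uh T (biorth2 ?uh k) = 0"
        by (simp add: kernel_form_perturbed T)
    qed
    with \<open>T \<noteq> 0\<close> show False by simp
  qed
  then have "v i * factor_H u (n + i) = 0"
    using pairing[of "n + i"] \<open>i < N\<close> by (simp add: T kernel_form_0_left[OF u(1)])
  then show ?thesis
    using factor_H_nonzero[OF u(2)] by simp
qed

text \<open>
  The Fourier coefficients of \<open>W P'\<^sub>n\<close> with respect to \<open>u\<close> are pairings of \<open>P'\<^sub>n\<close> for the perturbed
  kernel: they vanish at indices below \<open>n\<close> and produce the perturbed norm at index \<open>n\<close>. If \<open>N = 0\<close> the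
  coefficient at index \<open>n\<close> is the leading one, outside the sum, hence the premise of the second fact.
\<close>
lemma connection_formula:
  assumes u: "generalized_kernel u" "quasi_definite u"
    and uh: "quasi_definite (perturbed_kernel W u)"
    and W: "lead_coeff W = 1" "Polynomial.degree W = N"
  obtains q where
    "W * biorth1 (perturbed_kernel W u) n
      = (\<Sum>i<N. smult (q i) (biorth1 u (n + i))) + biorth1 u (n + N)"
    "N \<ge> 1 \<Longrightarrow> q 0 * factor_H u n = factor_H (perturbed_kernel W u) n"
proof -
  let ?uh = "perturbed_kernel W u"
  have uh: "generalized_kernel ?uh" "quasi_definite ?uh"
    using u uh generalized_kernel_perturbed by simp_all
  note basis = monic_basis_biorth1[OF u(2)] monic_basis_biorth1[OF uh(2)]
    monic_basis_biorth2[OF u(2)]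
  have deg: "Polynomial.degree (biorth1 ?uh n) = n"
    using basis(2) by (intro antisym degree_le le_degree) (auto simp: monic_basis_def)
  have nz: "W \<noteq> 0" "biorth1 ?uh n \<noteq> 0"
    using W basis(2) by (auto simp: monic_basis_def dest: spec[of _ n])
  then have deg_prod: "Polynomial.degree (W * biorth1 ?uh n) = n + N"
    using deg W(2) by (simp add: degree_mult_eq)
  then have "\<And>j. Suc (n + N) \<le> j \<Longrightarrow> Polynomial.coeff (W * biorth1 ?uh n) j = 0"
    by (simp add: coeff_eq_0)
  from monic_basis_expansion[OF basis(1) this]
  obtain q where q: "W * biorth1 ?uh n = (\<Sum>k<Suc (n + N). smult (q k) (biorth1 u k))" by metis
  have "Polynomial.coeff (W * biorth1 ?uh n) (n + N) = 1"
    using lead_coeff_mult[of W "biorth1 ?uh n"] W(1) deg basis(2) deg_prod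
    by (simp add: monic_basis_def)
  then have top: "q (n + N) = 1"
    using basis(1) unfolding q by (simp add: coeff_sum monic_basis_def)
  have pairing: "kernel_form ?uh (biorth1 ?uh n) (biorth2 u l) = q l * factor_H u l"
    if "l \<le> n" for l
    unfolding kernel_form_perturbed q using that by (subst fourier_coefficient1[OF u]) auto
  have "q l = 0" if l: "l < n" for l
  proof -
    have "kernel_form ?uh (biorth1 ?uh n) (biorth2 u l) = 0"
    proof (rule orthogonal_to_low_degree[OF uh(1) monic_basis_biorth2[OF uh(2)], of n])
      show "kernel_form ?uh (biorth1 ?uh n) (biorth2 ?uh k) = 0" if "k < n" for k
        using that by (simp add: biorthogonality[OF uh])
      show "Polynomial.coeff (biorth2 u l) j = 0" if "n \<le> j" for j
        using that l basis(3) by (simp add: monic_basis_def)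
    qed
    then show ?thesis
      using pairing[of l] l factor_H_nonzero[OF u(2), of l] by simp
  qed
  then have "(\<Sum>k<n + N. smult (q k) (biorth1 u k)) = (\<Sum>k\<in>{n..<n + N}. smult (q k) (biorth1 u k))"
    by (intro sum.mono_neutral_right) auto
  also have "\<dots> = (\<Sum>i<N. smult (q (n + i)) (biorth1 u (n + i)))"
    unfolding lessThan_atLeast0
    using sum.shift_bounds_nat_ivl[of "\<lambda>k. smult (q k) (biorth1 u k)" 0 n N]
    by (simp add: add.commute)
  finally have "W * biorth1 ?uh n
      = (\<Sum>i<N. smult (q (n + i)) (biorth1 u (n + i))) + biorth1 u (n + N)"
    by (simp add: q top)
  moreover have "q n * factor_H u n = factor_H ?uh n"
    using pairing[of n] basis(3) biorth1_pairing_monic[OF uh, of "biorth2 u n" n]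
    by (simp add: monic_basis_def)
  ultimately show thesis using that[of "\<lambda>i. q (n + i)"] by simp
qed

text \<open>
  The right-hand side is \<open>L\<close> applied to the first variable of the Christoffel--Darboux kernel. Pairing
  it with \<open>F\<close> from the left reproduces \<open>L\<close> on the part of \<open>F\<close> in the span of \<open>P\<^sub>0, ..., P\<^sub>n\<close>, and for
  \<open>deg F < n + N\<close> the remaining part does not contribute because \<open>L\<close> kills the rest of the window.
  So the pairing is \<open>L F\<close>, which is zero on multiples of \<open>W\<close>.
\<close>
lemma biorth2_perturbed_as_functional_of_kernel:
  fixes L :: "complex poly \<Rightarrow> complex"
  assumes u: "generalized_kernel u" "quasi_definite u"
    and uh: "quasi_definite (perturbed_kernel W u)"
    and W: "Polynomial.degree W = N" "N \<ge> 1"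
    and L_sum: "\<And>(A :: nat set) c F. L (\<Sum>k\<in>A. smult (c k) (F k)) = (\<Sum>k\<in>A. c k * L (F k))"
    and L_multiple: "\<And>p. L (W * p) = 0"
    and L_n: "L (biorth1 u n) = factor_H u n"
    and L_window: "\<And>k. n < k \<Longrightarrow> k < n + N \<Longrightarrow> L (biorth1 u k) = 0"
  shows "biorth2 (perturbed_kernel W u) n
    = (\<Sum>k\<le>n. smult (L (biorth1 u k) / factor_H u k) (biorth2 u k))"
proof -
  let ?uh = "perturbed_kernel W u" and ?P = "biorth1 u"
  have uh: "generalized_kernel ?uh" "quasi_definite ?uh"
    using u uh generalized_kernel_perturbed by simp_all
  note basis = monic_basis_biorth1[OF u(2)] monic_basis_biorth1[OF uh(2)]
    monic_basis_biorth2[OF u(2)]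
  define Q where "Q = (\<Sum>k\<le>n. smult (L (?P k) / factor_H u k) (biorth2 u k))"
  have "Q = biorth2 ?uh n"
  proof (rule biorth2_unique[OF uh])
    show "Polynomial.coeff Q n = 1"
      using L_n basis(3) factor_H_nonzero[OF u(2), of n]
      by (simp add: Q_def coeff_sum monic_basis_def lessThan_Suc_atMost[symmetric])
    show "Polynomial.coeff Q j = 0" if "n < j" for j
      using that basis(3) by (simp add: Q_def coeff_sum monic_basis_def)
    fix k assume k: "k < n"
    have "Polynomial.degree (biorth1 ?uh k) \<le> k"
      using basis(2) by (intro degree_le) (auto simp: monic_basis_def)
    then have "Polynomial.degree (W * biorth1 ?uh k) \<le> N + k"
      using degree_mult_le[of W "biorth1 ?uh k"] W(1) by simp
    then have "\<And>j. n + N \<le> j \<Longrightarrow> Polynomial.coeff (W * biorth1 ?uh k) j = 0"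
      using k by (simp add: coeff_eq_0)
    from monic_basis_expansion[OF basis(1) this]
    obtain s where s: "W * biorth1 ?uh k = (\<Sum>l<n + N. smult (s l) (?P l))" by metis
    have "kernel_form ?uh (biorth1 ?uh k) Q
      = (\<Sum>l\<le>n. L (?P l) / factor_H u l * kernel_form u (W * biorth1 ?uh k) (biorth2 u l))"
      unfolding kernel_form_perturbed Q_def by (rule kernel_form_sum_right[OF u(1)])
    also have "\<dots> = (\<Sum>l\<le>n. s l * L (?P l))"
    proof (intro sum.cong refl)
      fix l assume "l \<in> {..n}"
      then have "kernel_form u (W * biorth1 ?uh k) (biorth2 u l) = s l * factor_H u l"
        unfolding s using W(2) by (subst fourier_coefficient1[OF u]) auto
      then show "L (?P l) / factor_H u l * kernel_form u (W * biorth1 ?uh k) (biorth2 u l)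
        = s l * L (?P l)"
        using factor_H_nonzero[OF u(2), of l] by simp
    qed
    also have "\<dots> = (\<Sum>l<n + N. s l * L (?P l))"
      using W(2) L_window by (intro sum.mono_neutral_left) auto
    also have "\<dots> = L (W * biorth1 ?uh k)"
      unfolding s by (rule L_sum[symmetric])
    also have "\<dots> = 0" by (rule L_multiple)
    finally show "kernel_form ?uh (biorth1 ?uh k) Q = 0" .
  qed
  then show ?thesis by (simp add: Q_def)
qed

section \<open>Jets of polynomials\<close>

lemma higher_deriv_poly: "(deriv ^^ j) (poly p) = poly ((pderiv ^^ j) p)" for p :: "complex poly"
proof (induction j)
  case (Suc j)
  have "deriv (poly q) = poly (pderiv q)" for q :: "complex poly"
    by (intro ext DERIV_imp_deriv poly_DERIV)
  with Suc show ?case by simp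
qed simp

text \<open>
  Pairs of a root index and a derivative order, in the order in which the jet lists them.
\<close>
definition jet_positions :: "nat \<Rightarrow> (nat \<Rightarrow> nat) \<Rightarrow> (nat \<times> nat) list" where
  "jet_positions d m = concat (map (\<lambda>i. map (Pair i) [0..<m i]) [1..<d + 1])"

lemma jet_poly:
  "jet d r m (poly p) =
    map (\<lambda>(i, j). poly ((pderiv ^^ j) p) (r i) / fact j) (jet_positions d m)"
  by (simp add: jet_def jet_positions_def map_concat higher_deriv_poly comp_def)

lemma length_jet: "length (jet d r m f) = (\<Sum>i = 1..d. m i)"
proof -
  have "length (jet d r m f) = sum_list (map m [1..<d + 1])"
    by (simp add: jet_def length_concat comp_def)
  also have "\<dots> = (\<Sum>i = 1..d. m i)"
    by (subst sum_list_distinct_conv_sum_set) (auto intro: sum.cong)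
  finally show ?thesis .
qed

lemma jet_poly_sum:
  assumes "t < (\<Sum>i = 1..d. m i)"
  shows "jet d r m (poly (\<Sum>k\<in>A. smult (c k) (P k))) ! t
    = (\<Sum>k\<in>A. c k * jet d r m (poly (P k)) ! t)"
proof -
  have "t < length (jet_positions d m)"
    using assms length_jet[of d r m "poly 0"] by (simp add: jet_poly)
  then show ?thesis
    by (simp add: jet_poly higher_pderiv_sum higher_pderiv_smult poly_sum sum_divide_distrib
        split: prod.split)
qed

text \<open>
  Induction on the exponent: in characteristic \<open>0\<close> the derivative lowers the order of a root by exactly
  one.
\<close>
lemma power_linear_dvd_iff_derivatives_vanish:
  fixes p :: "complex poly"
  shows "[:- a, 1:] ^ n dvd p \<longleftrightarrow> (\<forall>j<n. poly ((pderiv ^^ j) p) a = 0)"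
proof (induction n arbitrary: p)
  case (Suc n)
  show ?case
  proof (cases "p = 0")
    case False
    have "[:- a, 1:] ^ Suc n dvd p \<longleftrightarrow> poly p a = 0 \<and> [:- a, 1:] ^ n dvd pderiv p"
    proof (cases "poly p a = 0")
      case True
      have "pderiv p \<noteq> 0"
      proof
        assume "pderiv p = 0"
        then have "Polynomial.degree p = 0" by (simp add: pderiv_eq_0_iff)
        then obtain c where "p = [:c:]" by (rule degree_eq_zeroE)
        then show False using True False by simp
      qed
      then show ?thesis
        using order_pderiv[OF False True] False True by (simp add: order_divides del: power_Suc)
    next
      case False
      then show ?thesis
        by (metis dvd_trans dvd_triv_left poly_eq_0_iff_dvd power_Suc)
    qed
    also have "\<dots> \<longleftrightarrow> (\<forall>j<Suc n. poly ((pderiv ^^ j) p) a = 0)"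
      by (simp add: Suc.IH All_less_Suc2 funpow_Suc_right del: funpow.simps)
    finally show ?thesis .
  qed simp
qed simp

text \<open>
  After dividing by the factors already treated, the order at a new root is unchanged, since these
  factors do not vanish there.
\<close>
lemma prod_power_linear_dvd_iff:
  fixes p :: "complex poly"
  assumes "finite I" and "inj_on r I"
  shows "(\<Prod>i\<in>I. [:- r i, 1:] ^ m i) dvd p \<longleftrightarrow> (\<forall>i\<in>I. [:- r i, 1:] ^ m i dvd p)"
proof
  assume "(\<Prod>i\<in>I. [:- r i, 1:] ^ m i) dvd p"
  then show "\<forall>i\<in>I. [:- r i, 1:] ^ m i dvd p"
    using dvd_prodI[OF assms(1)] dvd_trans by blast
next
  assume "\<forall>i\<in>I. [:- r i, 1:] ^ m i dvd p"
  with assms show "(\<Prod>i\<in>I. [:- r i, 1:] ^ m i) dvd p"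
  proof (induction I rule: finite_induct)
    case (insert i I)
    let ?W = "\<Prod>i\<in>I. [:- r i, 1:] ^ m i"
    obtain q where q: "p = ?W * q"
      using insert by (auto elim: dvdE)
    show ?case
    proof (cases "p = 0")
      case False
      have "poly ?W (r i) \<noteq> 0"
        using insert.hyps insert.prems(1) by (auto simp: poly_prod)
      then have "order (r i) p = order (r i) q"
        using False unfolding q by (subst order_mult) (auto simp: order_0I)
      then have "[:- r i, 1:] ^ m i dvd q"
        using insert.prems(2) False q by (simp add: order_divides)
      then show ?thesis
        using insert.hyps unfolding q by (simp add: mult.commute mult_dvd_mono)
    qed simp
  qed simp
qed

lemma jet_vanishes_iff_dvd:
  assumes "inj_on r {1..d}"
  shows "(\<forall>t<(\<Sum>i = 1..d. m i). jet d r m (poly p) ! t = 0)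
    \<longleftrightarrow> (\<Prod>i = 1..d. [:- r i, 1:] ^ m i) dvd p"
proof -
  have "(\<forall>t<(\<Sum>i = 1..d. m i). jet d r m (poly p) ! t = 0)
    \<longleftrightarrow> (\<forall>z\<in>set (jet d r m (poly p)). z = 0)"
    by (simp add: all_set_conv_all_nth length_jet)
  also have "\<dots> \<longleftrightarrow> (\<forall>i\<in>{1..d}. \<forall>j<m i. poly ((pderiv ^^ j) p) (r i) = 0)"
    by (auto simp: jet_poly jet_positions_def less_Suc_eq_le)
  finally show ?thesis
    using assms by (simp add: prod_power_linear_dvd_iff power_linear_dvd_iff_derivatives_vanish)
qed

section \<open>The Christoffel formulas\<close>

theorem proposition38:
  fixes u :: "complex poly poly \<Rightarrow> complex"
    and d N n :: nat
    and r :: "nat \<Rightarrow> complex"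
    and m :: "nat \<Rightarrow> nat"
    and W :: "complex poly"
    and uh :: "complex poly poly \<Rightarrow> complex"
  assumes "generalized_kernel u"
    and "inj_on r {1..d}"
    and "\<And>i. i \<in> {1..d} \<Longrightarrow> m i \<ge> 1"
    and "W = (\<Prod>i = 1..d. [:- r i, 1:] ^ m i)"
    and "N = (\<Sum>i = 1..d. m i)"
    and "N \<ge> 1"
    and "uh = perturbed_kernel W u"
    and "quasi_definite u"
    and "quasi_definite uh"
  shows
    "invertible_mat
       (mat_of_rows_list N (map (\<lambda>k. jet d r m (poly (biorth1 u k))) [n..<n + N])) \<and>
     (\<forall>x. poly W x \<noteq> 0 \<longrightarrow>
       poly (biorth1 uh n) x =
         1 / poly W x *
         quasi_det (mat_of_rows_list (N + 1)
           (map (\<lambda>k. jet d r m (poly (biorth1 u k)) @ [poly (biorth1 u k) x]) [n..<n + N + 1]))) \<and>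
     factor_H uh n =
       quasi_det (mat_of_rows_list (N + 1)
         ((jet d r m (poly (biorth1 u n)) @ [factor_H u n]) #
          map (\<lambda>k. jet d r m (poly (biorth1 u k)) @ [0]) [n + 1..<n + N + 1])) \<and>
     (\<forall>y. poly (biorth2 uh n) y =
       - quasi_det (mat_of_rows_list (N + 1)
           ((jet d r m (poly (biorth1 u n)) @ [factor_H u n]) #
            map (\<lambda>k. jet d r m (poly (biorth1 u k)) @ [0]) [n + 1..<n + N] @
            [jet d r m (\<lambda>x. CD_kernel u n x y) @ [0]])))"
proof -
  note W = assms(4) and N = assms(5) and uh = assms(7)
  note u = assms(1,8)
  have qdW: "quasi_definite (perturbed_kernel W u)" using assms(7,9) by simp
  have degW: "Polynomial.degree W = N"
    unfolding W N by (subst degree_prod_eq_sum_degree) (auto simp: degree_power_eq)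
  have lcW: "lead_coeff W = 1"
    unfolding W by (auto simp: lead_coeff_prod lead_coeff_power intro!: prod.neutral)
  have W0: "W \<noteq> 0" using lcW by auto
  define J where "J = (\<lambda>p. jet d r m (poly p))"
  have lenJ: "length (J p) = N" for p
    by (simp add: J_def length_jet N)
  have J_sum: "J (\<Sum>k\<in>A. smult (c k) (F k)) ! t = (\<Sum>k\<in>A. c k * J (F k) ! t)"
    if "t < N" for A t and c :: "nat \<Rightarrow> complex" and F
    using jet_poly_sum[of t m d r c F A] that by (simp add: J_def N)
  have J_zero: "(\<forall>t<N. J p ! t = 0) \<longleftrightarrow> W dvd p" for p
    using jet_vanishes_iff_dvd[OF assms(2), of m p] by (simp add: J_def N W)
  define P where "P = biorth1 u"
  define R where "R = (\<lambda>k. J (P k))"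
  have lenR: "length (R k) = N" for k by (simp add: R_def lenJ)

  have inv: "invertible_mat (mat_of_rows_list N (map R [n..<n + N]))"
  proof (rule invertible_mat_if_left_kernel_trivial, intro allI impI)
    fix v i
    assume v: "\<And>j. j < N \<Longrightarrow> (\<Sum>i<N. v i * R (n + i) ! j) = 0" and i: "i < N"
    have "\<forall>t<N. J (\<Sum>i<N. smult (v i) (P (n + i))) ! t = 0"
      using v by (simp add: J_sum R_def)
    then have "W dvd (\<Sum>i<N. smult (v i) (P (n + i)))"
      using J_zero by simp
    then show "v i = 0"
      using multiple_in_window_is_zero[OF u qdW W0 degW _ i] by (simp add: P_def)
  qed

  obtain q where q: "W * biorth1 uh n = (\<Sum>i<N. smult (q i) (P (n + i))) + P (n + N)"
    and q0: "q 0 * factor_H u n = factor_H uh n"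
    using connection_formula[OF u qdW lcW degW, of n] assms(6) unfolding P_def uh by metis
  \<comment> \<open>The left-hand side of the connection formula is a multiple of \<open>W\<close>, so its jet is zero:
    this expresses the jet of the last polynomial through the preceding ones.\<close>
  have relation: "R (n + N) ! t = (\<Sum>i<N. - q i * R (n + i) ! t)" if t: "t < N" for t
  proof -
    have "W * biorth1 uh n = (\<Sum>i<Suc N. smult ((q(N := 1)) i) (P (n + i)))"
      by (simp add: q)
    then have "J (W * biorth1 uh n) ! t = (\<Sum>i<Suc N. (q(N := 1)) i * J (P (n + i)) ! t)"
      using J_sum[OF t, of "q(N := 1)" "\<lambda>i. P (n + i)" "{..<Suc N}"] by simp
    moreover have "J (W * biorth1 uh n) ! t = 0"
      using J_zero[of "W * biorth1 uh n"] t by simp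
    ultimately have "(\<Sum>i<N. q i * R (n + i) ! t) + R (n + N) ! t = 0"
      by (simp add: R_def)
    from minus_unique[OF this] show ?thesis
      by (simp add: sum_negf)
  qed
  \<comment> \<open>The last column is arbitrary: the values at \<open>x\<close> give the polynomials, the column
    \<open>(H\<^sub>n, 0, ..., 0)\<close> gives the norms.\<close>
  have bordered: "quasi_det (mat_of_rows_list (N + 1) (map (\<lambda>k. R k @ [b k]) [n..<n + N + 1]))
    = b (n + N) + (\<Sum>i<N. q i * b (n + i))" for b
    using quasi_det_by_row_relation[OF lenR lenR inv relation, of b "b (n + N)"]
    by (simp add: sum_negf)

  have P1: "poly (biorth1 uh n) x = 1 / poly W x *
      quasi_det (mat_of_rows_list (N + 1) (map (\<lambda>k. R k @ [poly (P k) x]) [n..<n + N + 1]))"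
    if "poly W x \<noteq> 0" for x
  proof -
    have "poly W x * poly (biorth1 uh n) x = poly (W * biorth1 uh n) x" by simp
    also have "\<dots> = poly (P (n + N)) x + (\<Sum>i<N. q i * poly (P (n + i)) x)"
      unfolding q by (simp add: poly_sum)
    finally show ?thesis
      unfolding bordered using that by (simp add: field_simps)
  qed

  let ?b = "\<lambda>k. if k = n then factor_H u n else 0"
  have head: "(R n @ [factor_H u n]) # map (\<lambda>k. R k @ [0]) [n + 1..<M] = map (\<lambda>k. R k @ [?b k]) [n..<M]"
    if "n < M" for M
    using that by (simp add: upt_conv_Cons)
  have H: "factor_H uh n = quasi_det (mat_of_rows_list (N + 1)
      ((R n @ [factor_H u n]) # map (\<lambda>k. R k @ [0]) [n + 1..<n + N + 1]))"
  proof -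
    have "(\<Sum>i<N. q i * ?b (n + i)) = q 0 * factor_H u n"
      using assms(6) by (simp add: if_distrib[where f="\<lambda>x. _ * x"] cong: if_cong)
    then have "factor_H uh n = ?b (n + N) + (\<Sum>i<N. q i * ?b (n + i))"
      using q0 assms(6) by simp
    also have "\<dots> = quasi_det (mat_of_rows_list (N + 1) (map (\<lambda>k. R k @ [?b k]) [n..<n + N + 1]))"
      by (rule bordered[symmetric])
    finally show ?thesis
      by (subst head) simp_all
  qed

  have P2: "poly (biorth2 uh n) y = - quasi_det (mat_of_rows_list (N + 1)
      ((R n @ [factor_H u n]) # map (\<lambda>k. R k @ [0]) [n + 1..<n + N] @
        [jet d r m (\<lambda>x. CD_kernel u n x y) @ [0]]))" for y
  proof -
    obtain z where z: "\<And>i. i < N \<Longrightarrow> (\<Sum>j<N. R (n + i) ! j * z j) = ?b (n + i)"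
      and qd: "\<And>c e. length c = N \<Longrightarrow>
         quasi_det (mat_of_rows_list (N + 1) (map (\<lambda>k. R k @ [?b k]) [n..<n + N] @ [c @ [e]]))
         = e - (\<Sum>j<N. c ! j * z j)"
    proof (rule quasi_det_by_column_relation[OF lenR inv, of ?b], goal_cases)
      case (1 z)
      show ?case by (rule 1(1)) (fact 1(2), fact 1(3))
    qed
    \<comment> \<open>The functional takes the values \<open>H\<^sub>n, 0, ..., 0\<close> on \<open>P\<^sub>n, ..., P\<^sub>n\<^sub>+\<^sub>N\<^sub>-\<^sub>1\<close>, and its value on the
      kernel is minus the quasi-determinant of the matrix bordered by the jet of the kernel.\<close>
    define L where "L = (\<lambda>p. \<Sum>j<N. J p ! j * z j)"
    have L_sum: "L (\<Sum>k\<in>A. smult (c k) (F k)) = (\<Sum>k\<in>A. c k * L (F k))"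
      for A and c :: "nat \<Rightarrow> complex" and F
      unfolding L_def sum_distrib_left
      by (subst sum.swap) (simp add: J_sum sum_distrib_right mult.assoc)
    have L_P: "L (P k) = ?b k" if "n \<le> k" "k < n + N" for k
      using z[of "k - n"] that by (simp add: L_def R_def)
    have L_W: "L (W * p) = 0" for p
      using J_zero[of "W * p"] by (simp add: L_def)
    have "biorth2 uh n = (\<Sum>k\<le>n. smult (L (P k) / factor_H u k) (biorth2 u k))"
      unfolding uh P_def
    proof (rule biorth2_perturbed_as_functional_of_kernel[OF u qdW degW assms(6) L_sum L_W])
      show "L (biorth1 u n) = factor_H u n"
        using L_P[of n] assms(6) by (simp add: P_def)
      show "L (biorth1 u k) = 0" if "n < k" "k < n + N" for k
        using L_P[of k] that by (simp add: P_def)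
    qed
    moreover have CD: "(\<lambda>x. CD_kernel u n x y)
      = poly (\<Sum>k\<le>n. smult (poly (biorth2 u k) y * inverse (factor_H u k)) (P k))"
      by (intro ext) (simp add: CD_kernel_def P_def poly_sum)
    ultimately have "poly (biorth2 uh n) y
      = L (\<Sum>k\<le>n. smult (poly (biorth2 u k) y * inverse (factor_H u k)) (P k))"
      unfolding L_sum by (simp add: poly_sum field_simps)
    also have "\<dots> = - quasi_det (mat_of_rows_list (N + 1) (map (\<lambda>k. R k @ [?b k]) [n..<n + N]
        @ [jet d r m (\<lambda>x. CD_kernel u n x y) @ [0]]))"
      by (subst qd) (simp_all add: L_def J_def CD length_jet N)
    finally show ?thesis
      by (subst append_Cons[symmetric], subst head) (use assms(6) in simp_all)
  qed
  show ?thesis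
    using inv P1 H P2 unfolding R_def J_def P_def by (intro conjI allI impI)
qed

end
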